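(* Let $F,G\colon(\mathscr C,C)\to(\mathscr D,D)$ be computability transfers and let $\alpha,\beta\colon F\Rightarrow G$ be natural transformations. Then the equifier of $\alpha$ and $\beta$ in $\mathsf{CatBaseComp}$ is given by the category $\mathrm{Eq}(\alpha,\beta)$ whose objects are those objects $c$ of $\mathscr C$ with $\alpha_c=\beta_c$ and whose arrows are all arrows of $\mathscr C$ between such objects, with the base of computability $\mathrm{Equi}(C,D)$ consisting of all arrows in $C$ that are in $\mathrm{Eq}(\alpha,\beta)$, that is, $\mathrm{Equi}(C,D)(c)$ consists of the arrows of $C(c)$ lying in $\mathrm{Eq}(\alpha,\beta)$, for all $c\in\mathrm{Eq}(\alpha,\beta)$. The computability transfer $I\colon\big(\mathrm{Eq}(\alpha,\beta),\mathrm{Equi}(C,D)\big)\to(\mathscr C,C)$ of the equifier is the inclusion.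
   Context: A base of computability $B$ in a category $\mathscr C$ is a family $(B(a))_{a\in\mathscr C_0}$, where each $B(a)$ is a subclass of the class $\mathrm{Mon}(-,a)$ of monomorphisms with codomain $a$, such that: (Base1) $1_a\in B(a)$ for every object $a$; (Base2) for all objects $a,b$, all $i\colon s\to a$ in $B(a)$, all $j\colon t\to b$ in $B(b)$, and all $f\colon s\to b$, there is a pullback of $j$ along $f$, with projection $f^*j\colon j^*(s)\to s$, such that $i\circ f^*j\in B(a)$. If $C$, $D$ are bases of computability in $\mathscr C$, $\mathscr D$, a computability transfer $F\colon(\mathscr C,C)\to(\mathscr D,D)$ is a functor $F\colon\mathscr C\to\mathscr D$ such that $F(i)\in D(F(a))$ for all objects $a$ and all $i\in C(a)$, and $F$ preserves all pullbacks occurring in (Base2) (i.e. pullbacks of arrows $j\in C(b)$ along arbitrary arrows $f\colon s\to b$). $\mathsf{CatBaseComp}$ is the 2-category with objects the categories with a base of computability, 1-cells the computability transfers, and 2-cells the natural transformations between underlying functors. An equifier of 2-cells $\gamma_0,\gamma_1\colon f\Rightarrow g$ between 1-cells $f,g\colon A\to B$ in a 2-category is an object $I$ with a 1-cell $i\colon I\to A$ such that $\gamma_0*i=\gamma_1*i$ and which is universal: (1) for every $j\colon J\to A$ with $\gamma_0*j=\gamma_1*j$ there is a unique $h\colon J\to I$ with $j=i\circ h$; (2) for two such $j,j'\colon J\to A$, with induced $h,h'$, and every $\nu\colon j\Rightarrow j'$ there is a unique $\mu\colon h\Rightarrow h'$ with $i*\mu=\nu$. *)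

theory Defs
  imports "HOL-Library.FuncSet"
begin

section \<open>Categories, pullbacks and bases of computability\<close>

record ('o, 'a) cat =
  Ob :: "'o set"
  Ar :: "'a set"
  Dom :: "'a \<Rightarrow> 'o"
  Cod :: "'a \<Rightarrow> 'o"
  Ident :: "'o \<Rightarrow> 'a"
  Comp :: "'a \<Rightarrow> 'a \<Rightarrow> 'a"  \<comment> \<open>\<open>Comp C g f\<close> is \<open>g \<circ> f\<close>\<close>

definition hom :: "('o, 'a) cat \<Rightarrow> 'o \<Rightarrow> 'o \<Rightarrow> 'a set" where
  "hom C x y = {f \<in> Ar C. Dom C f = x \<and> Cod C f = y}"

locale category =
  fixes C :: "('o, 'a) cat"
  assumes Dom_closed: "f \<in> Ar C \<Longrightarrow> Dom C f \<in> Ob C"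
    and Cod_closed: "f \<in> Ar C \<Longrightarrow> Cod C f \<in> Ob C"
    and Ident_hom: "x \<in> Ob C \<Longrightarrow> Ident C x \<in> hom C x x"
    and Comp_hom: "f \<in> hom C x y \<Longrightarrow> g \<in> hom C y z \<Longrightarrow> Comp C g f \<in> hom C x z"
    and Comp_Ident_right: "f \<in> hom C x y \<Longrightarrow> Comp C f (Ident C x) = f"
    and Comp_Ident_left: "f \<in> hom C x y \<Longrightarrow> Comp C (Ident C y) f = f"
    and Comp_assoc: "f \<in> hom C x y \<Longrightarrow> g \<in> hom C y z \<Longrightarrow> h \<in> hom C z w
      \<Longrightarrow> Comp C h (Comp C g f) = Comp C (Comp C h g) f"

definition monic :: "('o, 'a) cat \<Rightarrow> 'a \<Rightarrow> bool" where
  "monic C m \<longleftrightarrow> m \<in> Ar C \<and>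
    (\<forall>x. \<forall>u \<in> hom C x (Dom C m). \<forall>v \<in> hom C x (Dom C m).
       Comp C m u = Comp C m v \<longrightarrow> u = v)"

text \<open>
  \<open>is_pullback C j f p q\<close>: the square \<open>f \<circ> p = j \<circ> q\<close> is a pullback of \<open>j\<close> along \<open>f\<close>;
  thus \<open>p\<close> is the projection written \<open>f\<^sup>*j\<close>.
\<close>
definition is_pullback :: "('o, 'a) cat \<Rightarrow> 'a \<Rightarrow> 'a \<Rightarrow> 'a \<Rightarrow> 'a \<Rightarrow> bool" where
  "is_pullback C j f p q \<longleftrightarrow>
     j \<in> Ar C \<and> f \<in> Ar C \<and> Cod C j = Cod C f \<and>
     p \<in> Ar C \<and> q \<in> Ar C \<and> Dom C p = Dom C q \<and> Cod C p = Dom C f \<and> Cod C q = Dom C j \<and>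
     Comp C f p = Comp C j q \<and>
     (\<forall>x. \<forall>u \<in> hom C x (Dom C f). \<forall>v \<in> hom C x (Dom C j).
        Comp C f u = Comp C j v \<longrightarrow>
          (\<exists>!w. w \<in> hom C x (Dom C p) \<and> Comp C p w = u \<and> Comp C q w = v))"

text \<open>Values of a base outside the set of objects carry no meaning.\<close>
definition computability_base :: "('o, 'a) cat \<Rightarrow> ('o \<Rightarrow> 'a set) \<Rightarrow> bool" where
  "computability_base C B \<longleftrightarrow>
     (\<forall>a \<in> Ob C. \<forall>i \<in> B a. monic C i \<and> Cod C i = a) \<and>
     (\<forall>a \<in> Ob C. Ident C a \<in> B a) \<and>
     (\<forall>a \<in> Ob C. \<forall>b \<in> Ob C. \<forall>i \<in> B a. \<forall>j \<in> B b. \<forall>f \<in> hom C (Dom C i) b.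
        \<exists>p q. is_pullback C j f p q \<and> Comp C i p \<in> B a)"

record ('o, 'a) based_cat =
  Cat :: "('o, 'a) cat"
  Base :: "'o \<Rightarrow> 'a set"

definition is_based_cat :: "('o, 'a) based_cat \<Rightarrow> bool" where
  "is_based_cat X \<longleftrightarrow> category (Cat X) \<and> computability_base (Cat X) (Base X)"


section \<open>Functors, computability transfers and natural transformations\<close>

definition is_functor ::
  "('o, 'a) cat \<Rightarrow> ('p, 'b) cat \<Rightarrow> ('o \<Rightarrow> 'p) \<Rightarrow> ('a \<Rightarrow> 'b) \<Rightarrow> bool" where
  "is_functor C D Fo Fa \<longleftrightarrow>
     (\<forall>x \<in> Ob C. Fo x \<in> Ob D) \<and>
     (\<forall>f \<in> Ar C. Fa f \<in> hom D (Fo (Dom C f)) (Fo (Cod C f))) \<and>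
     (\<forall>x \<in> Ob C. Fa (Ident C x) = Ident D (Fo x)) \<and>
     (\<forall>f \<in> Ar C. \<forall>g \<in> Ar C. Cod C f = Dom C g \<longrightarrow> Fa (Comp C g f) = Comp D (Fa g) (Fa f))"

record ('o, 'a) transfer =
  Src :: "('o, 'a) based_cat"
  Trg :: "('o, 'a) based_cat"
  OMap :: "'o \<Rightarrow> 'o"
  AMap :: "'a \<Rightarrow> 'a"

text \<open>
  The maps of a transfer, and the components of a transformation, are \<open>undefined\<close> outside the source
  category, so that HOL equality of these records is equality of functors and of natural
  transformations.
\<close>
definition is_transfer :: "('o, 'a) transfer \<Rightarrow> bool" where
  "is_transfer F \<longleftrightarrow>
     (let C = Cat (Src F); D = Cat (Trg F) in
       is_based_cat (Src F) \<and> is_based_cat (Trg F) \<and>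
       is_functor C D (OMap F) (AMap F) \<and>
       OMap F \<in> extensional (Ob C) \<and> AMap F \<in> extensional (Ar C) \<and>
       (\<forall>a \<in> Ob C. \<forall>i \<in> Base (Src F) a. AMap F i \<in> Base (Trg F) (OMap F a)) \<and>
       (\<forall>b \<in> Ob C. \<forall>j \<in> Base (Src F) b. \<forall>f p q. is_pullback C j f p q \<longrightarrow>
          is_pullback D (AMap F j) (AMap F f) (AMap F p) (AMap F q)))"

record ('o, 'a) transformation =
  NSrc :: "('o, 'a) transfer"
  NTrg :: "('o, 'a) transfer"
  At :: "'o \<Rightarrow> 'a"

definition is_transformation :: "('o, 'a) transformation \<Rightarrow> bool" where
  "is_transformation \<tau> \<longleftrightarrow>
     (let F = NSrc \<tau>; G = NTrg \<tau>; C = Cat (Src F); D = Cat (Trg F) in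
       is_transfer F \<and> is_transfer G \<and> Src F = Src G \<and> Trg F = Trg G \<and>
       At \<tau> \<in> extensional (Ob C) \<and>
       (\<forall>x \<in> Ob C. At \<tau> x \<in> hom D (OMap F x) (OMap G x)) \<and>
       (\<forall>f \<in> Ar C. Comp D (At \<tau> (Cod C f)) (AMap F f) = Comp D (AMap G f) (At \<tau> (Dom C f))))"


section \<open>2-categories and equifiers\<close>

record ('x, 'f, 't) two_cat =
  Obj :: "'x set"
  Cell1 :: "'f set"
  Cell2 :: "'t set"
  src1 :: "'f \<Rightarrow> 'x"
  trg1 :: "'f \<Rightarrow> 'x"
  src2 :: "'t \<Rightarrow> 'f"
  trg2 :: "'t \<Rightarrow> 'f"
  id1 :: "'x \<Rightarrow> 'f"
  comp1 :: "'f \<Rightarrow> 'f \<Rightarrow> 'f"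
  id2 :: "'f \<Rightarrow> 't"
  vcomp :: "'t \<Rightarrow> 't \<Rightarrow> 't"
  hcomp :: "'t \<Rightarrow> 't \<Rightarrow> 't"

definition one_cell :: "('x, 'f, 't) two_cat \<Rightarrow> 'f \<Rightarrow> 'x \<Rightarrow> 'x \<Rightarrow> bool" where
  "one_cell K f A B \<longleftrightarrow> f \<in> Cell1 K \<and> src1 K f = A \<and> trg1 K f = B"

definition two_cell :: "('x, 'f, 't) two_cat \<Rightarrow> 't \<Rightarrow> 'f \<Rightarrow> 'f \<Rightarrow> bool" where
  "two_cell K \<gamma> f g \<longleftrightarrow> \<gamma> \<in> Cell2 K \<and> src2 K \<gamma> = f \<and> trg2 K \<gamma> = g"

locale two_category =
  fixes K :: "('x, 'f, 't) two_cat"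
  assumes cells1: "category \<lparr>Ob = Obj K, Ar = Cell1 K, Dom = src1 K, Cod = trg1 K,
                             Ident = id1 K, Comp = comp1 K\<rparr>"
    and vertical: "category \<lparr>Ob = Cell1 K, Ar = Cell2 K, Dom = src2 K, Cod = trg2 K,
                             Ident = id2 K, Comp = vcomp K\<rparr>"
    and horizontal: "category \<lparr>Ob = Obj K, Ar = Cell2 K,
                               Dom = src1 K \<circ> src2 K, Cod = trg1 K \<circ> src2 K,
                               Ident = id2 K \<circ> id1 K, Comp = hcomp K\<rparr>"
    and globular: "two_cell K \<gamma> f g \<Longrightarrow> src1 K f = src1 K g \<and> trg1 K f = trg1 K g"
    and hcomp_cell: "two_cell K \<gamma> f f' \<Longrightarrow> two_cell K \<delta> g g' \<Longrightarrow> trg1 K f = src1 K g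
      \<Longrightarrow> two_cell K (hcomp K \<delta> \<gamma>) (comp1 K g f) (comp1 K g' f')"
    and hcomp_id2: "f \<in> Cell1 K \<Longrightarrow> g \<in> Cell1 K \<Longrightarrow> trg1 K f = src1 K g
      \<Longrightarrow> hcomp K (id2 K g) (id2 K f) = id2 K (comp1 K g f)"
    and interchange: "two_cell K \<gamma> f f' \<Longrightarrow> two_cell K \<gamma>' f' f'' \<Longrightarrow>
      two_cell K \<delta> g g' \<Longrightarrow> two_cell K \<delta>' g' g'' \<Longrightarrow> trg1 K f = src1 K g
      \<Longrightarrow> hcomp K (vcomp K \<delta>' \<delta>) (vcomp K \<gamma>' \<gamma>) = vcomp K (hcomp K \<delta>' \<gamma>') (hcomp K \<delta> \<gamma>)"

definition whisker_right :: "('x, 'f, 't) two_cat \<Rightarrow> 't \<Rightarrow> 'f \<Rightarrow> 't" where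
  "whisker_right K \<gamma> i = hcomp K \<gamma> (id2 K i)"

definition whisker_left :: "('x, 'f, 't) two_cat \<Rightarrow> 'f \<Rightarrow> 't \<Rightarrow> 't" where
  "whisker_left K i \<mu> = hcomp K (id2 K i) \<mu>"

definition equifies :: "('x, 'f, 't) two_cat \<Rightarrow> 't \<Rightarrow> 't \<Rightarrow> 'f \<Rightarrow> bool" where
  "equifies K \<gamma>0 \<gamma>1 j \<longleftrightarrow> whisker_right K \<gamma>0 j = whisker_right K \<gamma>1 j"

text \<open>
  The pair \<open>I\<close>, \<open>i : I \<rightarrow> A\<close> is an equifier of \<open>\<gamma>0, \<gamma>1 : f \<Rightarrow> g\<close>, where \<open>f, g : A \<rightarrow> B\<close>.
  In the last clause \<open>h\<close> and \<open>h'\<close> are the 1-cells induced by \<open>j\<close> and \<open>j'\<close>.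
\<close>
definition is_equifier ::
  "('x, 'f, 't) two_cat \<Rightarrow> 'x \<Rightarrow> 'x \<Rightarrow> 'f \<Rightarrow> 'f \<Rightarrow> 't \<Rightarrow> 't \<Rightarrow> 'x \<Rightarrow> 'f \<Rightarrow> bool" where
  "is_equifier K A B f g \<gamma>0 \<gamma>1 I i \<longleftrightarrow>
     one_cell K f A B \<and> one_cell K g A B \<and> two_cell K \<gamma>0 f g \<and> two_cell K \<gamma>1 f g \<and>
     I \<in> Obj K \<and> one_cell K i I A \<and> equifies K \<gamma>0 \<gamma>1 i \<and>
     (\<forall>J \<in> Obj K. \<forall>j. one_cell K j J A \<and> equifies K \<gamma>0 \<gamma>1 j \<longrightarrow>
        (\<exists>!h. one_cell K h J I \<and> j = comp1 K i h)) \<and>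
     (\<forall>J \<in> Obj K. \<forall>j j' h h' \<nu>.
        one_cell K j J A \<and> equifies K \<gamma>0 \<gamma>1 j \<and> one_cell K j' J A \<and> equifies K \<gamma>0 \<gamma>1 j' \<and>
        one_cell K h J I \<and> j = comp1 K i h \<and> one_cell K h' J I \<and> j' = comp1 K i h' \<and>
        two_cell K \<nu> j j' \<longrightarrow>
        (\<exists>!\<mu>. two_cell K \<mu> h h' \<and> whisker_left K i \<mu> = \<nu>))"


section \<open>The 2-category of categories with a base of computability\<close>

definition id_transfer :: "('o, 'a) based_cat \<Rightarrow> ('o, 'a) transfer" where
  "id_transfer X = \<lparr>Src = X, Trg = X, OMap = \<lambda>x \<in> Ob (Cat X). x, AMap = \<lambda>f \<in> Ar (Cat X). f\<rparr>"

definition comp_transfer ::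
  "('o, 'a) transfer \<Rightarrow> ('o, 'a) transfer \<Rightarrow> ('o, 'a) transfer" where
  "comp_transfer G F = \<lparr>Src = Src F, Trg = Trg G,
     OMap = compose (Ob (Cat (Src F))) (OMap G) (OMap F),
     AMap = compose (Ar (Cat (Src F))) (AMap G) (AMap F)\<rparr>"

definition id_transformation :: "('o, 'a) transfer \<Rightarrow> ('o, 'a) transformation" where
  "id_transformation F = \<lparr>NSrc = F, NTrg = F,
     At = \<lambda>x \<in> Ob (Cat (Src F)). Ident (Cat (Trg F)) (OMap F x)\<rparr>"

definition vcomp_transformation ::
  "('o, 'a) transformation \<Rightarrow> ('o, 'a) transformation \<Rightarrow> ('o, 'a) transformation" where
  "vcomp_transformation \<tau> \<sigma> = \<lparr>NSrc = NSrc \<sigma>, NTrg = NTrg \<tau>,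
     At = \<lambda>x \<in> Ob (Cat (Src (NSrc \<sigma>))). Comp (Cat (Trg (NSrc \<sigma>))) (At \<tau> x) (At \<sigma> x)\<rparr>"

text \<open>For \<open>\<sigma> : F \<Rightarrow> F'\<close> and \<open>\<tau> : G \<Rightarrow> G'\<close> the component at \<open>x\<close> is \<open>G' \<sigma>\<^sub>x \<circ> \<tau>\<^bsub>F x\<^esub>\<close>.\<close>
definition hcomp_transformation ::
  "('o, 'a) transformation \<Rightarrow> ('o, 'a) transformation \<Rightarrow> ('o, 'a) transformation" where
  "hcomp_transformation \<tau> \<sigma> = \<lparr>
     NSrc = comp_transfer (NSrc \<tau>) (NSrc \<sigma>), NTrg = comp_transfer (NTrg \<tau>) (NTrg \<sigma>),
     At = \<lambda>x \<in> Ob (Cat (Src (NSrc \<sigma>))).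
            Comp (Cat (Trg (NSrc \<tau>))) (AMap (NTrg \<tau>) (At \<sigma> x)) (At \<tau> (OMap (NSrc \<sigma>) x))\<rparr>"

text \<open>
  The type parameters play the role of the universe from which objects and arrows of the categories
  are taken.
\<close>
definition CatBaseComp ::
  "(('o, 'a) based_cat, ('o, 'a) transfer, ('o, 'a) transformation) two_cat" where
  "CatBaseComp = \<lparr>
     Obj = {X. is_based_cat X}, Cell1 = {F. is_transfer F}, Cell2 = {\<tau>. is_transformation \<tau>},
     src1 = Src, trg1 = Trg, src2 = NSrc, trg2 = NTrg,
     id1 = id_transfer, comp1 = comp_transfer,
     id2 = id_transformation, vcomp = vcomp_transformation, hcomp = hcomp_transformation\<rparr>"


subsection \<open>The 2-category laws\<close>

lemma CatBaseComp_simps [simp]: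
  "Obj CatBaseComp = {X. is_based_cat X}" "Cell1 CatBaseComp = {F. is_transfer F}"
  "Cell2 CatBaseComp = {\<tau>. is_transformation \<tau>}"
  "src1 CatBaseComp = Src" "trg1 CatBaseComp = Trg"
  "src2 CatBaseComp = NSrc" "trg2 CatBaseComp = NTrg"
  "id1 CatBaseComp = id_transfer" "comp1 CatBaseComp = comp_transfer"
  "id2 CatBaseComp = id_transformation" "vcomp CatBaseComp = vcomp_transformation"
  "hcomp CatBaseComp = hcomp_transformation"
  by (simp_all add: CatBaseComp_def)

lemma is_transferD:
  assumes "is_transfer F"
  shows "is_based_cat (Src F)" "is_based_cat (Trg F)"
    "category (Cat (Src F))" "category (Cat (Trg F))"
    "OMap F \<in> extensional (Ob (Cat (Src F)))" "AMap F \<in> extensional (Ar (Cat (Src F)))"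
    "x \<in> Ob (Cat (Src F)) \<Longrightarrow> OMap F x \<in> Ob (Cat (Trg F))"
    "f \<in> hom (Cat (Src F)) x y \<Longrightarrow> AMap F f \<in> hom (Cat (Trg F)) (OMap F x) (OMap F y)"
    "x \<in> Ob (Cat (Src F)) \<Longrightarrow> AMap F (Ident (Cat (Src F)) x) = Ident (Cat (Trg F)) (OMap F x)"
    "f \<in> hom (Cat (Src F)) x y \<Longrightarrow> g \<in> hom (Cat (Src F)) y z \<Longrightarrow>
       AMap F (Comp (Cat (Src F)) g f) = Comp (Cat (Trg F)) (AMap F g) (AMap F f)"
  using assms by (auto simp: is_transfer_def Let_def is_functor_def is_based_cat_def hom_def)

lemma is_transformationD:
  assumes "is_transformation \<tau>"
  shows "is_transfer (NSrc \<tau>)" "is_transfer (NTrg \<tau>)"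
    "Src (NTrg \<tau>) = Src (NSrc \<tau>)" "Trg (NTrg \<tau>) = Trg (NSrc \<tau>)"
    "At \<tau> \<in> extensional (Ob (Cat (Src (NSrc \<tau>))))"
    "x \<in> Ob (Cat (Src (NSrc \<tau>))) \<Longrightarrow>
       At \<tau> x \<in> hom (Cat (Trg (NSrc \<tau>))) (OMap (NSrc \<tau>) x) (OMap (NTrg \<tau>) x)"
    "f \<in> hom (Cat (Src (NSrc \<tau>))) x y \<Longrightarrow>
       Comp (Cat (Trg (NSrc \<tau>))) (At \<tau> y) (AMap (NSrc \<tau>) f) =
       Comp (Cat (Trg (NSrc \<tau>))) (AMap (NTrg \<tau>) f) (At \<tau> x)"
  using assms by (auto simp: is_transformation_def Let_def hom_def)

lemma transfer_eqI:
  assumes "is_transfer F" "is_transfer G" "Src F = Src G" "Trg F = Trg G"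
    and "\<And>x. x \<in> Ob (Cat (Src G)) \<Longrightarrow> OMap F x = OMap G x"
    and "\<And>f. f \<in> Ar (Cat (Src G)) \<Longrightarrow> AMap F f = AMap G f"
  shows "F = G"
proof -
  have "OMap F = OMap G" "AMap F = AMap G"
    using assms is_transferD(5,6)[OF assms(1)] is_transferD(5,6)[OF assms(2)]
    by (auto intro: extensionalityI)
  then show ?thesis using assms by simp
qed

lemma transformation_eqI:
  assumes "is_transformation \<sigma>" "is_transformation \<tau>" "NSrc \<sigma> = NSrc \<tau>" "NTrg \<sigma> = NTrg \<tau>"
    and "\<And>x. x \<in> Ob (Cat (Src (NSrc \<tau>))) \<Longrightarrow> At \<sigma> x = At \<tau> x"
  shows "\<sigma> = \<tau>"
proof -
  have "At \<sigma> = At \<tau>"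
    using assms is_transformationD(5)[OF assms(1)] is_transformationD(5)[OF assms(2)]
    by (auto intro: extensionalityI)
  then show ?thesis using assms by simp
qed

lemma is_id_transfer:
  assumes "is_based_cat X"
  shows "is_transfer (id_transfer X)"
proof -
  interpret category "Cat X" using assms by (simp add: is_based_cat_def)
  have "Ident (Cat X) x \<in> Ar (Cat X)" if "x \<in> Ob (Cat X)" for x
    using Ident_hom[OF that] by (simp add: hom_def)
  moreover have "Comp (Cat X) g f \<in> Ar (Cat X)"
    if "f \<in> Ar (Cat X)" "g \<in> Ar (Cat X)" "Cod (Cat X) f = Dom (Cat X) g" for f g
    using Comp_hom[of f _ "Dom (Cat X) g" g] that by (simp add: hom_def)
  moreover have "Base X a \<subseteq> Ar (Cat X)" if "a \<in> Ob (Cat X)" for a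
    using assms that by (auto simp: is_based_cat_def computability_base_def monic_def)
  moreover have "j \<in> Ar (Cat X)" "f \<in> Ar (Cat X)" "p \<in> Ar (Cat X)" "q \<in> Ar (Cat X)"
    if "is_pullback (Cat X) j f p q" for j f p q
    using that by (auto simp: is_pullback_def)
  ultimately show ?thesis
    using assms Dom_closed Cod_closed
    by (auto simp: is_transfer_def id_transfer_def Let_def is_functor_def hom_def subset_iff)
qed

lemma is_comp_transfer:
  assumes F: "is_transfer F" and G: "is_transfer G" and FG: "Trg F = Src G"
  shows "is_transfer (comp_transfer G F)"
proof -
  interpret category "Cat (Src F)" using is_transferD(3)[OF F] .
  let ?C = "Cat (Src F)"
  have i: "Ident ?C x \<in> Ar ?C" if "x \<in> Ob ?C" for x
    using Ident_hom[OF that] by (simp add: hom_def)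
  have c: "Comp ?C g f \<in> Ar ?C" if "f \<in> Ar ?C" "g \<in> Ar ?C" "Cod ?C f = Dom ?C g" for f g
    using Comp_hom[of f _ "Dom ?C g" g] that by (simp add: hom_def)
  have b: "Base (Src F) a \<subseteq> Ar ?C" if "a \<in> Ob ?C" for a
    using is_transferD(1)[OF F] that by (auto simp: is_based_cat_def computability_base_def monic_def)
  have fn: "is_functor ?C (Cat (Trg G)) (compose (Ob ?C) (OMap G) (OMap F)) (compose (Ar ?C) (AMap G) (AMap F))"
    using F G FG i c Dom_closed Cod_closed
    by (auto simp: is_transfer_def Let_def is_functor_def compose_def hom_def)
  have bs: "AMap G (AMap F j) \<in> Base (Trg G) (OMap G (OMap F a))"
    if "a \<in> Ob ?C" "j \<in> Base (Src F) a" for a j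
    using F G FG that by (simp add: is_transfer_def Let_def is_functor_def)
  have pb: "is_pullback (Cat (Trg G)) (AMap G (AMap F j)) (AMap G (AMap F f))
      (AMap G (AMap F p)) (AMap G (AMap F q))"
    if "a \<in> Ob ?C" "j \<in> Base (Src F) a" "is_pullback ?C j f p q" for a j f p q
  proof -
    have "OMap F a \<in> Ob (Cat (Src G))" "AMap F j \<in> Base (Src G) (OMap F a)"
      using F FG that by (auto simp: is_transfer_def Let_def is_functor_def)
    moreover have "is_pullback (Cat (Src G)) (AMap F j) (AMap F f) (AMap F p) (AMap F q)"
      using F FG that by (auto simp: is_transfer_def Let_def)
    ultimately show ?thesis using G by (auto simp: is_transfer_def Let_def)
  qed
  have ar: "j \<in> Ar ?C" "f \<in> Ar ?C" "p \<in> Ar ?C" "q \<in> Ar ?C" if "is_pullback ?C j f p q" for j f p q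
    using that by (auto simp: is_pullback_def)
  show ?thesis
    unfolding is_transfer_def comp_transfer_def Let_def
    using fn is_transferD(1)[OF F] is_transferD(2)[OF G] bs pb b ar
    by (simp add: compose_eq subset_iff)
qed

lemma comp_transfer_simps [simp]:
  "Src (comp_transfer G F) = Src F" "Trg (comp_transfer G F) = Trg G"
  "x \<in> Ob (Cat (Src F)) \<Longrightarrow> OMap (comp_transfer G F) x = OMap G (OMap F x)"
  "f \<in> Ar (Cat (Src F)) \<Longrightarrow> AMap (comp_transfer G F) f = AMap G (AMap F f)"
  by (simp_all add: comp_transfer_def compose_eq)

lemma id_transfer_simps [simp]:
  "Src (id_transfer X) = X" "Trg (id_transfer X) = X"
  "x \<in> Ob (Cat X) \<Longrightarrow> OMap (id_transfer X) x = x"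
  "f \<in> Ar (Cat X) \<Longrightarrow> AMap (id_transfer X) f = f"
  by (simp_all add: id_transfer_def)

lemma transformation_simps [simp]:
  "NSrc (id_transformation F) = F" "NTrg (id_transformation F) = F"
  "NSrc (vcomp_transformation \<tau> \<sigma>) = NSrc \<sigma>" "NTrg (vcomp_transformation \<tau> \<sigma>) = NTrg \<tau>"
  "NSrc (hcomp_transformation \<tau> \<sigma>) = comp_transfer (NSrc \<tau>) (NSrc \<sigma>)"
  "NTrg (hcomp_transformation \<tau> \<sigma>) = comp_transfer (NTrg \<tau>) (NTrg \<sigma>)"
  "x \<in> Ob (Cat (Src F)) \<Longrightarrow> At (id_transformation F) x = Ident (Cat (Trg F)) (OMap F x)"
  "x \<in> Ob (Cat (Src (NSrc \<sigma>))) \<Longrightarrow>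
    At (vcomp_transformation \<tau> \<sigma>) x = Comp (Cat (Trg (NSrc \<sigma>))) (At \<tau> x) (At \<sigma> x)"
  "x \<in> Ob (Cat (Src (NSrc \<sigma>))) \<Longrightarrow>
    At (hcomp_transformation \<tau> \<sigma>) x =
      Comp (Cat (Trg (NSrc \<tau>))) (AMap (NTrg \<tau>) (At \<sigma> x)) (At \<tau> (OMap (NSrc \<sigma>) x))"
  by (simp_all add: id_transformation_def vcomp_transformation_def hcomp_transformation_def)

lemma is_transformationI:
  assumes "is_transfer (NSrc \<tau>)" "is_transfer (NTrg \<tau>)"
    "Src (NTrg \<tau>) = Src (NSrc \<tau>)" "Trg (NTrg \<tau>) = Trg (NSrc \<tau>)"
    "At \<tau> \<in> extensional (Ob (Cat (Src (NSrc \<tau>))))"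
    "\<And>x. x \<in> Ob (Cat (Src (NSrc \<tau>))) \<Longrightarrow>
       At \<tau> x \<in> hom (Cat (Trg (NSrc \<tau>))) (OMap (NSrc \<tau>) x) (OMap (NTrg \<tau>) x)"
    "\<And>f x y. f \<in> hom (Cat (Src (NSrc \<tau>))) x y \<Longrightarrow>
       x \<in> Ob (Cat (Src (NSrc \<tau>))) \<Longrightarrow> y \<in> Ob (Cat (Src (NSrc \<tau>))) \<Longrightarrow>
       Comp (Cat (Trg (NSrc \<tau>))) (At \<tau> y) (AMap (NSrc \<tau>) f) =
       Comp (Cat (Trg (NSrc \<tau>))) (AMap (NTrg \<tau>) f) (At \<tau> x)"
  shows "is_transformation \<tau>"
  using assms category.Dom_closed[OF is_transferD(3)[OF assms(1)]]
    category.Cod_closed[OF is_transferD(3)[OF assms(1)]]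
  by (auto simp: is_transformation_def Let_def hom_def)

lemma is_id_transformation:
  assumes F: "is_transfer F"
  shows "is_transformation (id_transformation F)"
proof -
  interpret D: category "Cat (Trg F)" using is_transferD(4)[OF F] .
  show ?thesis
  proof (rule is_transformationI, goal_cases)
    case (6 x)
    then show ?case using is_transferD(7)[OF F] D.Ident_hom by simp
  next
    case (7 f x y)
    then have "AMap F f \<in> hom (Cat (Trg F)) (OMap F x) (OMap F y)"
      using is_transferD(8)[OF F] by simp
    then show ?case using 7 D.Comp_Ident_right D.Comp_Ident_left by simp
  qed (use F in \<open>auto simp: id_transformation_def[THEN arg_cong[of _ _ At]]\<close>)
qed

lemma is_vcomp_transformation:
  assumes s: "is_transformation \<sigma>" and t: "is_transformation \<tau>" and st: "NTrg \<sigma> = NSrc \<tau>"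
  shows "is_transformation (vcomp_transformation \<tau> \<sigma>)"
proof -
  note [simp] = is_transformationD(3,4)[OF s] is_transformationD(3,4)[OF t] st[symmetric]
  let ?C = "Cat (Src (NSrc \<sigma>))" and ?D = "Cat (Trg (NSrc \<sigma>))"
  interpret D: category ?D using is_transferD(4)[OF is_transformationD(1)[OF s]] .
  have hs: "At \<sigma> x \<in> hom ?D (OMap (NSrc \<sigma>) x) (OMap (NTrg \<sigma>) x)"
    and ht: "At \<tau> x \<in> hom ?D (OMap (NTrg \<sigma>) x) (OMap (NTrg \<tau>) x)" if "x \<in> Ob ?C" for x
    using is_transformationD(6)[OF s] is_transformationD(6)[OF t] that by auto
  show ?thesis
  proof (rule is_transformationI, goal_cases)
    case (6 x)
    then show ?case using D.Comp_hom[OF hs ht] by simp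
  next
    case (7 f x y)
    then have f: "f \<in> hom ?C x y" and x: "x \<in> Ob ?C" and y: "y \<in> Ob ?C" by auto
    have F: "AMap (NSrc \<sigma>) f \<in> hom ?D (OMap (NSrc \<sigma>) x) (OMap (NSrc \<sigma>) y)"
      and G: "AMap (NTrg \<sigma>) f \<in> hom ?D (OMap (NTrg \<sigma>) x) (OMap (NTrg \<sigma>) y)"
      and H: "AMap (NTrg \<tau>) f \<in> hom ?D (OMap (NTrg \<tau>) x) (OMap (NTrg \<tau>) y)"
      using is_transferD(8)[OF is_transformationD(1)[OF s], of f x y]
        is_transferD(8)[OF is_transformationD(2)[OF s], of f x y]
        is_transferD(8)[OF is_transformationD(2)[OF t], of f x y] f by auto
    have ns: "Comp ?D (At \<sigma> y) (AMap (NSrc \<sigma>) f) = Comp ?D (AMap (NTrg \<sigma>) f) (At \<sigma> x)"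
      using is_transformationD(7)[OF s f] .
    have nt: "Comp ?D (At \<tau> y) (AMap (NTrg \<sigma>) f) = Comp ?D (AMap (NTrg \<tau>) f) (At \<tau> x)"
      using is_transformationD(7)[OF t, of f x y] f by simp
    show ?case
      using x y D.Comp_assoc[OF F hs[OF y] ht[OF y]] D.Comp_assoc[OF hs[OF x] G ht[OF y]]
        D.Comp_assoc[OF hs[OF x] ht[OF x] H] ns nt by simp
  qed (use s t hs ht D.Comp_hom in
    \<open>auto simp: is_transformationD(1,2) vcomp_transformation_def[THEN arg_cong[of _ _ At]]\<close>)
qed

lemma is_hcomp_transformation:
  assumes s: "is_transformation \<sigma>" and t: "is_transformation \<tau>"
    and st: "Trg (NSrc \<sigma>) = Src (NSrc \<tau>)"
  shows "is_transformation (hcomp_transformation \<tau> \<sigma>)"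
proof -
  note [simp] = is_transformationD(3,4)[OF s] is_transformationD(3,4)[OF t] st[symmetric]
  let ?F = "NSrc \<sigma>" and ?F' = "NTrg \<sigma>" and ?G = "NSrc \<tau>" and ?G' = "NTrg \<tau>"
  let ?C = "Cat (Src ?F)" and ?D = "Cat (Trg ?F)" and ?E = "Cat (Trg ?G)"
  note F = is_transformationD(1)[OF s] and F' = is_transformationD(2)[OF s]
    and G = is_transformationD(1)[OF t] and G' = is_transformationD(2)[OF t]
  interpret E: category ?E using is_transferD(4)[OF G] .
  have ob: "OMap ?F x \<in> Ob ?D" "OMap ?F' x \<in> Ob ?D" if "x \<in> Ob ?C" for x
    using is_transferD(7)[OF F] is_transferD(7)[OF F'] that by auto
  have hs: "At \<sigma> x \<in> hom ?D (OMap ?F x) (OMap ?F' x)" if "x \<in> Ob ?C" for x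
    using is_transformationD(6)[OF s] that by auto
  have ht: "At \<tau> (OMap ?F x) \<in> hom ?E (OMap ?G (OMap ?F x)) (OMap ?G' (OMap ?F x))"
    if "x \<in> Ob ?C" for x using is_transformationD(6)[OF t] ob(1)[OF that] by auto
  have hG: "AMap ?G' u \<in> hom ?E (OMap ?G' x) (OMap ?G' y)" if "u \<in> hom ?D x y" for u x y
    using is_transferD(8)[OF G'] that by auto
  show ?thesis
  proof (rule is_transformationI, goal_cases)
    case (6 x)
    then show ?case using ob E.Comp_hom[OF ht hG[OF hs]] by simp
  next
    case (7 f x y)
    then have f: "f \<in> hom ?C x y" and x: "x \<in> Ob ?C" and y: "y \<in> Ob ?C" by auto
    then have fa: "f \<in> Ar ?C" by (simp add: hom_def)
    have Ff: "AMap ?F f \<in> hom ?D (OMap ?F x) (OMap ?F y)"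
      and F'f: "AMap ?F' f \<in> hom ?D (OMap ?F' x) (OMap ?F' y)"
      using is_transferD(8)[OF F f] is_transferD(8)[OF F', of f x y] f by auto
    have GFf: "AMap ?G (AMap ?F f) \<in> hom ?E (OMap ?G (OMap ?F x)) (OMap ?G (OMap ?F y))"
      using is_transferD(8)[OF G] Ff by auto
    have ns: "Comp ?D (At \<sigma> y) (AMap ?F f) = Comp ?D (AMap ?F' f) (At \<sigma> x)"
      using is_transformationD(7)[OF s f] .
    have nt: "Comp ?E (At \<tau> (OMap ?F y)) (AMap ?G (AMap ?F f))
        = Comp ?E (AMap ?G' (AMap ?F f)) (At \<tau> (OMap ?F x))"
      using is_transformationD(7)[OF t, of "AMap ?F f"] Ff by simp
    have "Comp ?E (AMap ?G' (At \<sigma> y)) (AMap ?G' (AMap ?F f))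
        = Comp ?E (AMap ?G' (AMap ?F' f)) (AMap ?G' (At \<sigma> x))"
      using is_transferD(10)[OF G', of "AMap ?F f" _ _ "At \<sigma> y"]
        is_transferD(10)[OF G', of "At \<sigma> x" _ _ "AMap ?F' f"] Ff F'f hs[OF x] hs[OF y] ns by auto
    then show ?case
      using x y fa nt E.Comp_assoc[OF GFf ht[OF y] hG[OF hs[OF y]]]
        E.Comp_assoc[OF ht[OF x] hG[OF Ff] hG[OF hs[OF y]]]
        E.Comp_assoc[OF ht[OF x] hG[OF hs[OF x]] hG[OF F'f]] by simp
  qed (use F F' G G' in
    \<open>auto intro: is_comp_transfer simp: hcomp_transformation_def[THEN arg_cong[of _ _ At]]\<close>)
qed


lemma category_cells1:
  "category \<lparr>Ob = {X. is_based_cat X}, Ar = {F. is_transfer F}, Dom = Src, Cod = Trg,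
             Ident = id_transfer, Comp = comp_transfer\<rparr>"
proof (unfold_locales, goal_cases)
  case (5 F X Y)
  then have "is_transfer F" "Src F = X" by (auto simp: hom_def)
  moreover from this have "is_transfer (comp_transfer F (id_transfer X))"
    using is_transferD(1)[of F] by (auto intro: is_comp_transfer is_id_transfer)
  ultimately show ?case by (auto intro: transfer_eqI)
next
  case (6 F X Y)
  then have F: "is_transfer F" "Trg F = Y" by (auto simp: hom_def)
  moreover from this have "is_transfer (comp_transfer (id_transfer Y) F)"
    using is_transferD(2)[of F] by (auto intro: is_comp_transfer is_id_transfer)
  moreover have "AMap F f \<in> Ar (Cat Y)" if "f \<in> Ar (Cat (Src F))" for f
    using is_transferD(8)[OF F(1), of f "Dom (Cat (Src F)) f" "Cod (Cat (Src F)) f"] that F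
    by (simp add: hom_def)
  ultimately show ?case using is_transferD(7)[OF F(1)] by (auto intro!: transfer_eqI)
next
  case (7 F X Y G Z H W)
  then have F: "is_transfer F" "is_transfer G" "is_transfer H" "Trg F = Src G" "Trg G = Src H"
    by (auto simp: hom_def)
  have "AMap F f \<in> Ar (Cat (Src G))" if "f \<in> Ar (Cat (Src F))" for f
    using is_transferD(8)[OF F(1), of f "Dom (Cat (Src F)) f" "Cod (Cat (Src F)) f"] that F
    by (simp add: hom_def)
  then show ?case
    using is_transferD(7)[OF F(1)] F by (auto intro!: transfer_eqI is_comp_transfer)
qed (auto simp: hom_def is_transferD(1,2) intro: is_id_transfer is_comp_transfer)

lemma category_vertical:
  "category \<lparr>Ob = {F. is_transfer F}, Ar = {\<tau>. is_transformation \<tau>}, Dom = NSrc, Cod = NTrg,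
             Ident = id_transformation, Comp = vcomp_transformation\<rparr>"
proof (unfold_locales, goal_cases)
  case (5 s F G)
  then have s: "is_transformation s" "NSrc s = F" by (auto simp: hom_def)
  then have F: "is_transfer F" using is_transformationD(1) by auto
  interpret D: category "Cat (Trg F)" using is_transferD(4)[OF F] .
  show ?case
    using s F D.Comp_Ident_right[OF is_transformationD(6)[OF s(1), unfolded s(2)]]
    by (auto intro!: transformation_eqI is_vcomp_transformation is_id_transformation)
next
  case (6 s F G)
  then have s: "is_transformation s" "NTrg s = G" by (auto simp: hom_def)
  then have G: "is_transfer G" using is_transformationD(2) by auto
  interpret D: category "Cat (Trg G)" using is_transferD(4)[OF G] .
  show ?case
    using s G is_transformationD(3,4)[OF s(1)]
      D.Comp_Ident_left[OF is_transformationD(6)[OF s(1), unfolded is_transformationD(4)[OF s(1), symmetric] s(2)]]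
    by (auto intro!: transformation_eqI is_vcomp_transformation is_id_transformation)
next
  case (7 s F G t H u K)
  then have s: "is_transformation s" and t: "is_transformation t" and u: "is_transformation u"
    and st: "NTrg s = NSrc t" and tu: "NTrg t = NSrc u" by (auto simp: hom_def)
  interpret D: category "Cat (Trg (NSrc s))" using is_transferD(4)[OF is_transformationD(1)[OF s]] .
  note e = is_transformationD(3,4)[OF s] is_transformationD(3,4)[OF t]
    is_transformationD(3,4)[OF u] st tu
  have "Comp (Cat (Trg (NSrc s))) (At u x) (Comp (Cat (Trg (NSrc s))) (At t x) (At s x)) =
      Comp (Cat (Trg (NSrc s))) (Comp (Cat (Trg (NSrc s))) (At u x) (At t x)) (At s x)"
    if "x \<in> Ob (Cat (Src (NSrc s)))" for x
    using that D.Comp_assoc is_transformationD(6)[OF s, of x] is_transformationD(6)[OF t, of x]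
      is_transformationD(6)[OF u, of x] e by simp
  then show ?case
    using s t u e by (auto intro!: transformation_eqI is_vcomp_transformation)
qed (auto simp: hom_def is_transformationD(1,2) intro: is_id_transformation is_vcomp_transformation)

lemma category_horizontal:
  "category \<lparr>Ob = {X. is_based_cat X}, Ar = {\<tau>. is_transformation \<tau>},
             Dom = Src \<circ> NSrc, Cod = Trg \<circ> NSrc,
             Ident = id_transformation \<circ> id_transfer, Comp = hcomp_transformation\<rparr>"
proof (unfold_locales, goal_cases)
  case (5 s X Y)
  then have s: "is_transformation s" "Src (NSrc s) = X" by (auto simp: hom_def)
  note e = is_transformationD(1-4)[OF s(1)]
  have X: "is_based_cat X" using is_transferD(1)[OF e(1)] s by simp
  interpret D: category "Cat (Trg (NSrc s))" using is_transferD(4)[OF e(1)] .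
  have u: "comp_transfer F (id_transfer X) = F" if "is_transfer F" "Src F = X" for F
    using category.Comp_Ident_right[OF category_cells1, of F X "Trg F"] that by (simp add: hom_def)
  show ?case
    using s e X u D.Comp_Ident_left[OF is_transformationD(6)[OF s(1)]] is_transferD(9)[OF e(2)]
    by (auto intro!: transformation_eqI is_hcomp_transformation is_id_transformation is_id_transfer)
next
  case (6 s X Y)
  then have s: "is_transformation s" "Trg (NSrc s) = Y" by (auto simp: hom_def)
  note e = is_transformationD(1-4)[OF s(1)]
  have Y: "is_based_cat Y" using is_transferD(2)[OF e(1)] s by simp
  interpret D: category "Cat Y" using is_transferD(4)[OF e(1)] s by simp
  have u: "comp_transfer (id_transfer Y) F = F" if "is_transfer F" "Trg F = Y" for F
    using category.Comp_Ident_left[OF category_cells1, of F "Src F" Y] that by (simp add: hom_def)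
  have "At s x \<in> Ar (Cat Y)" if "x \<in> Ob (Cat (Src (NSrc s)))" for x
    using is_transformationD(6)[OF s(1) that] s by (simp add: hom_def)
  then show ?case
    using s e Y u D.Comp_Ident_right[OF is_transformationD(6)[OF s(1), unfolded s(2)]]
      is_transferD(7)[OF e(1)]
    by (auto intro!: transformation_eqI is_hcomp_transformation is_id_transformation is_id_transfer)
next
  case (7 s X Y t Z u W)
  then have s: "is_transformation s" and t: "is_transformation t" and u: "is_transformation u"
    and st: "Trg (NSrc s) = Src (NSrc t)" and tu: "Trg (NSrc t) = Src (NSrc u)"
    by (auto simp: hom_def)
  note S = is_transformationD(1-4)[OF s] and T = is_transformationD(1-4)[OF t]
    and U = is_transformationD(1-4)[OF u]
  interpret E: category "Cat (Trg (NSrc u))" using is_transferD(4)[OF U(1)] .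
  have a: "comp_transfer H (comp_transfer G F) = comp_transfer (comp_transfer H G) F"
    if "is_transfer F" "is_transfer G" "is_transfer H" "Trg F = Src G" "Trg G = Src H"
    for F G H :: "('a, 'b) transfer"
    using category.Comp_assoc[OF category_cells1, of F "Src F" "Trg F" G "Trg G" H "Trg H"] that
    by (simp add: hom_def)
  have "hcomp_transformation u (hcomp_transformation t s)
      = hcomp_transformation (hcomp_transformation u t) s"
  proof (rule transformation_eqI)
    fix x assume "x \<in> Ob (Cat (Src (NSrc (hcomp_transformation (hcomp_transformation u t) s))))"
    then have x: "x \<in> Ob (Cat (Src (NSrc s)))" by simp
    let ?F = "NSrc s" and ?G = "NSrc t" and ?G' = "NTrg t" and ?H = "NSrc u" and ?H' = "NTrg u"
    have Fx: "OMap ?F x \<in> Ob (Cat (Src ?G))" using is_transferD(7)[OF S(1) x] st by simp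
    have GFx: "OMap ?G (OMap ?F x) \<in> Ob (Cat (Src ?H))" using is_transferD(7)[OF T(1) Fx] tu by simp
    have sx: "At s x \<in> hom (Cat (Src ?G)) (OMap ?F x) (OMap (NTrg s) x)"
      using is_transformationD(6)[OF s x] st by simp
    have tx: "At t (OMap ?F x) \<in> hom (Cat (Src ?H)) (OMap ?G (OMap ?F x)) (OMap ?G' (OMap ?F x))"
      using is_transformationD(6)[OF t Fx] tu by simp
    have gsx: "AMap ?G' (At s x) \<in> hom (Cat (Src ?H)) (OMap ?G' (OMap ?F x)) (OMap ?G' (OMap (NTrg s) x))"
      using is_transferD(8)[OF T(2)] sx T tu by auto
    note ux = is_transformationD(6)[OF u GFx]
    have m: "AMap ?H' f \<in> hom (Cat (Trg ?H)) (OMap ?H' y) (OMap ?H' z)"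
      if "f \<in> hom (Cat (Src ?H)) y z" for f y z
      using is_transferD(8)[OF U(2)] that U by auto
    show "At (hcomp_transformation u (hcomp_transformation t s)) x =
        At (hcomp_transformation (hcomp_transformation u t) s) x"
      using x Fx sx S T U st tu E.Comp_assoc[OF ux m[OF tx] m[OF gsx]]
        is_transferD(10)[OF U(2), of "At t (OMap ?F x)" _ _ "AMap ?G' (At s x)"] tx gsx
      by (auto simp: hom_def)
  qed (use s t u st tu S T U a in \<open>auto intro!: is_hcomp_transformation\<close>)
  then show ?case by simp
qed (auto simp: hom_def is_transformationD is_transferD(1,2)
      intro: is_id_transformation is_id_transfer is_hcomp_transformation)

lemma two_category_CatBaseComp: "two_category CatBaseComp"
proof (rule two_category.intro, goal_cases)
  case 1 show ?case using category_cells1 by simp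
next
  case 2 show ?case using category_vertical by simp
next
  case 3 show ?case using category_horizontal by simp
next
  case 4 then show ?case by (auto simp: two_cell_def is_transformationD)
next
  case 5 then show ?case by (auto simp: two_cell_def intro: is_hcomp_transformation)
next
  case (6 F G)
  then have F: "is_transfer F" and G: "is_transfer G" and FG: "Trg F = Src G" by auto
  interpret D: category "Cat (Trg G)" using is_transferD(4)[OF G] .
  have "Comp (Cat (Trg G)) (AMap G (Ident (Cat (Src G)) y)) (Ident (Cat (Trg G)) (OMap G y))
      = Ident (Cat (Trg G)) (OMap G y)" if "y \<in> Ob (Cat (Src G))" for y
    using is_transferD(7,9)[OF G that] D.Comp_Ident_left[OF D.Ident_hom] by simp
  then show ?case
    using F G FG is_transferD(7)[OF F]
    by (auto intro!: transformation_eqI is_hcomp_transformation is_id_transformation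
        is_comp_transfer)
next
  case (7 s F F' s' F'' t G G' t' G'')
  then have s: "is_transformation s" "NSrc s = F" "NTrg s = F'"
    and s': "is_transformation s'" "NSrc s' = F'" "NTrg s' = F''"
    and t: "is_transformation t" "NSrc t = G" "NTrg t = G'"
    and t': "is_transformation t'" "NSrc t' = G'" "NTrg t' = G''" and FG: "Trg F = Src G"
    by (auto simp: two_cell_def)
  have e: "Src F' = Src F" "Trg F' = Src G" "Src F'' = Src F" "Trg F'' = Src G"
    "Src G' = Src G" "Trg G' = Trg G" "Src G'' = Src G" "Trg G'' = Trg G"
    using is_transformationD(3,4)[OF s(1)] is_transformationD(3,4)[OF s'(1)]
      is_transformationD(3,4)[OF t(1)] is_transformationD(3,4)[OF t'(1)] s s' t t' FG by auto
  have tr: "is_transfer F" "is_transfer F'" "is_transfer G" "is_transfer G'" "is_transfer G''"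
    using s s' t t' is_transformationD(1,2) by blast+
  interpret E: category "Cat (Trg G)" using is_transferD(4)[OF tr(3)] .
  show ?case unfolding CatBaseComp_simps
  proof (rule transformation_eqI)
    fix x assume "x \<in> Ob (Cat (Src (NSrc (vcomp_transformation (hcomp_transformation t' s')
      (hcomp_transformation t s)))))"
    then have x: "x \<in> Ob (Cat (Src F))" using s by simp
    let ?E = "Cat (Trg G)" let ?c = "Comp ?E"
    have ob: "OMap F x \<in> Ob (Cat (Src G))" "OMap F' x \<in> Ob (Cat (Src G))"
      using is_transferD(7)[OF tr(1)] is_transferD(7)[OF tr(2)] x e FG by auto
    have sx: "At s x \<in> hom (Cat (Src G)) (OMap F x) (OMap F' x)"
      and sx': "At s' x \<in> hom (Cat (Src G)) (OMap F' x) (OMap F'' x)"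
      using is_transformationD(6)[OF s(1)] is_transformationD(6)[OF s'(1)] x s s' e FG by auto
    let ?p = "At t (OMap F x)" and ?q = "At t' (OMap F x)" and ?r = "At t' (OMap F' x)"
    let ?a = "AMap G' (At s x)" and ?b = "AMap G'' (At s x)" and ?d = "AMap G'' (At s' x)"
    have p: "?p \<in> hom ?E (OMap G (OMap F x)) (OMap G' (OMap F x))"
      using is_transformationD(6)[OF t(1)] ob t by auto
    have q: "?q \<in> hom ?E (OMap G' (OMap F x)) (OMap G'' (OMap F x))"
      and r: "?r \<in> hom ?E (OMap G' (OMap F' x)) (OMap G'' (OMap F' x))"
      using is_transformationD(6)[OF t'(1)] ob t' e by auto
    have a: "?a \<in> hom ?E (OMap G' (OMap F x)) (OMap G' (OMap F' x))"
      using is_transferD(8)[OF tr(4)] sx e by auto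
    have b: "?b \<in> hom ?E (OMap G'' (OMap F x)) (OMap G'' (OMap F' x))"
      and d: "?d \<in> hom ?E (OMap G'' (OMap F' x)) (OMap G'' (OMap F'' x))"
      using is_transferD(8)[OF tr(5)] sx sx' e by auto
    have n: "?c ?r ?a = ?c ?b ?q"
      using is_transformationD(7)[OF t'(1), of "At s x"] sx t' e by auto
    have f: "AMap G'' (Comp (Cat (Src G)) (At s' x) (At s x)) = ?c ?d ?b"
      using is_transferD(10)[OF tr(5)] sx sx' e by auto
    have "?c (?c ?d ?b) (?c ?q ?p) = ?c ?d (?c (?c ?b ?q) ?p)"
      using E.Comp_assoc[OF E.Comp_hom[OF p q] b d] E.Comp_assoc[OF p q b] by simp
    also have "\<dots> = ?c (?c ?d ?r) (?c ?a ?p)"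
      using E.Comp_assoc[OF E.Comp_hom[OF p a] r d] E.Comp_assoc[OF p a r] n by simp
    finally show "At (hcomp_transformation (vcomp_transformation t' t) (vcomp_transformation s' s)) x
      = At (vcomp_transformation (hcomp_transformation t' s') (hcomp_transformation t s)) x"
      using x ob s s' t t' e FG f by simp
  qed (use s s' t t' e FG in
      \<open>auto intro!: is_hcomp_transformation is_vcomp_transformation\<close>)
qed


section \<open>The full subcategory on which two transformations agree\<close>

definition Eq_cat ::
  "('o, 'a) cat \<Rightarrow> ('o, 'a) transformation \<Rightarrow> ('o, 'a) transformation \<Rightarrow> ('o, 'a) cat" where
  "Eq_cat C \<alpha> \<beta> = C\<lparr>
     Ob := {c \<in> Ob C. At \<alpha> c = At \<beta> c},
     Ar := {f \<in> Ar C. At \<alpha> (Dom C f) = At \<beta> (Dom C f) \<and> At \<alpha> (Cod C f) = At \<beta> (Cod C f)}\<rparr>"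

definition Equi ::
  "('o, 'a) based_cat \<Rightarrow> ('o, 'a) transformation \<Rightarrow> ('o, 'a) transformation \<Rightarrow> 'o \<Rightarrow> 'a set" where
  "Equi X \<alpha> \<beta> c = {i \<in> Base X c. i \<in> Ar (Eq_cat (Cat X) \<alpha> \<beta>)}"

definition Eq_based ::
  "('o, 'a) based_cat \<Rightarrow> ('o, 'a) transformation \<Rightarrow> ('o, 'a) transformation
     \<Rightarrow> ('o, 'a) based_cat" where
  "Eq_based X \<alpha> \<beta> = \<lparr>Cat = Eq_cat (Cat X) \<alpha> \<beta>, Base = Equi X \<alpha> \<beta>\<rparr>"

definition inclusion :: "('o, 'a) based_cat \<Rightarrow> ('o, 'a) based_cat \<Rightarrow> ('o, 'a) transfer" where
  "inclusion S X = \<lparr>Src = S, Trg = X, OMap = \<lambda>x \<in> Ob (Cat S). x, AMap = \<lambda>f \<in> Ar (Cat S). f\<rparr>"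

end

theory Submission
  imports Defs
begin

text \<open>
  Everything rests on one observation. If \<open>i : s \<rightarrow> a\<close> belongs to the base at an object \<open>a\<close> with
  \<open>\<alpha>\<^sub>a = \<beta>\<^sub>a\<close>, then \<open>\<alpha>\<^sub>s = \<beta>\<^sub>s\<close>: naturality gives \<open>G i \<circ> \<alpha>\<^sub>s = \<alpha>\<^sub>a \<circ> F i = \<beta>\<^sub>a \<circ> F i = G i \<circ> \<beta>\<^sub>s\<close>,
  and \<open>G i\<close> is monic because the transfer \<open>G\<close> sends \<open>i\<close> into a base
  (\<open>transformations_agree_on_domain\<close>). So the predicate \<open>\<alpha>\<^sub>c = \<beta>\<^sub>c\<close> on objects \<open>c\<close> is inherited along
  base arrows, from codomain to domain.

  For any predicate \<open>P\<close> inherited in this way the full subcategory on \<open>P\<close> carries the restricted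
  base, and its inclusion is a transfer. Indeed the pullback given by the second base axiom has a
  vertex which is the domain of a base arrow, hence satisfies \<open>P\<close>, and a pullback whose corners
  satisfy \<open>P\<close> is a pullback in the full subcategory (\<open>based_cat_full_based\<close>). Conversely, the
  inclusion preserves a pullback of a base arrow \<open>j\<close> along \<open>f\<close>: the ambient category has a pullback
  of \<open>j\<close> along \<open>f\<close> with vertex satisfying \<open>P\<close>, and the given square is isomorphic to it
  (\<open>transfer_inclusion\<close>).

  The universal property is then that of a full subcategory: a transfer into the ambient category
  corestricts as soon as its values on objects satisfy \<open>P\<close> (\<open>is_transfer_corestrict\<close>), and transformations
  correspond componentwise (\<open>ex1_whisker_inclusion\<close>). A transfer \<open>j\<close> equifies \<open>\<alpha>\<close> and \<open>\<beta>\<close> exactly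
  if its values on objects satisfy the predicate, since the component of \<open>\<alpha> * j\<close> at \<open>x\<close> is \<open>\<alpha>\<^bsub>j x\<^esub>\<close>
  (\<open>equifies_iff\<close>).
\<close>

section \<open>Full subcategories and their pullbacks\<close>

definition full_sub :: "('o, 'a) cat \<Rightarrow> ('o \<Rightarrow> bool) \<Rightarrow> ('o, 'a) cat" where
  "full_sub C P = C\<lparr>Ob := {c \<in> Ob C. P c}, Ar := {f \<in> Ar C. P (Dom C f) \<and> P (Cod C f)}\<rparr>"

lemma full_sub_simps [simp]:
  "Ob (full_sub C P) = {c \<in> Ob C. P c}"
  "Ar (full_sub C P) = {f \<in> Ar C. P (Dom C f) \<and> P (Cod C f)}"
  "Dom (full_sub C P) = Dom C" "Cod (full_sub C P) = Cod C"
  "Ident (full_sub C P) = Ident C" "Comp (full_sub C P) = Comp C"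
  by (simp_all add: full_sub_def)

lemma hom_in_Ar: "f \<in> hom C x y \<Longrightarrow> f \<in> Ar C"
  by (simp add: hom_def)

lemma hom_full_sub: "hom (full_sub C P) x y = {f \<in> hom C x y. P x \<and> P y}"
  by (auto simp: hom_def)

lemma category_full_sub:
  assumes "category C"
  shows "category (full_sub C P)"
proof -
  interpret category C by (rule assms)
  show ?thesis
    by unfold_locales
      (auto simp: hom_full_sub Dom_closed Cod_closed Ident_hom Comp_Ident_left Comp_Ident_right
        intro: Comp_hom Comp_assoc)
qed

lemma monic_full_sub:
  assumes "monic C m" "P (Dom C m)" "P (Cod C m)"
  shows "monic (full_sub C P) m"
  using assms by (auto simp: monic_def hom_full_sub)

lemma is_pullbackD:
  assumes "is_pullback C j f p q"
  shows "p \<in> hom C (Dom C p) (Dom C f)" "q \<in> hom C (Dom C p) (Dom C j)"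
    "f \<in> hom C (Dom C f) (Cod C j)" "j \<in> hom C (Dom C j) (Cod C j)"
    "Comp C f p = Comp C j q"
    "u \<in> hom C x (Dom C f) \<Longrightarrow> v \<in> hom C x (Dom C j) \<Longrightarrow> Comp C f u = Comp C j v \<Longrightarrow>
       \<exists>!w. w \<in> hom C x (Dom C p) \<and> Comp C p w = u \<and> Comp C q w = v"
proof -
  show "u \<in> hom C x (Dom C f) \<Longrightarrow> v \<in> hom C x (Dom C j) \<Longrightarrow> Comp C f u = Comp C j v \<Longrightarrow>
       \<exists>!w. w \<in> hom C x (Dom C p) \<and> Comp C p w = u \<and> Comp C q w = v"
    using assms unfolding is_pullback_def by blast
qed (use assms in \<open>auto simp: is_pullback_def hom_def\<close>)

lemma is_pullback_full_sub:
  assumes pb: "is_pullback C j f p q" and P: "P (Dom C j)" "P (Dom C f)" "P (Cod C j)" "P (Dom C p)"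
  shows "is_pullback (full_sub C P) j f p q"
proof -
  have "\<exists>!w. w \<in> hom (full_sub C P) x (Dom C p) \<and> Comp C p w = u \<and> Comp C q w = v"
    if "u \<in> hom (full_sub C P) x (Dom C f)" "v \<in> hom (full_sub C P) x (Dom C j)"
      "Comp C f u = Comp C j v" for x u v
    using is_pullbackD(6)[OF pb, of u x v] that P by (simp add: hom_full_sub)
  then show ?thesis
    using pb P unfolding is_pullback_def full_sub_simps by auto
qed

lemma pullback_jointly_monic:
  assumes "category C" and pb: "is_pullback C j f p q"
    and w: "w \<in> hom C x (Dom C p)" "w' \<in> hom C x (Dom C p)"
    and eq: "Comp C p w = Comp C p w'" "Comp C q w = Comp C q w'"
  shows "w = w'"
proof -
  interpret category C by (rule assms)
  note D = is_pullbackD[OF pb]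
  have "Comp C f (Comp C p w) = Comp C j (Comp C q w)"
    using Comp_assoc[OF w(1) D(1) D(3)] Comp_assoc[OF w(1) D(2) D(4)] D(5) by simp
  from D(6)[OF Comp_hom[OF w(1) D(1)] Comp_hom[OF w(1) D(2)] this] show ?thesis
    using w eq by metis
qed

text \<open>
  A full inclusion need not preserve pullbacks. It preserves those of two arrows which have, in the
  ambient category, some pullback with vertex in the subcategory: that square is then a pullback in
  the subcategory as well, so any other one there is isomorphic to it.
\<close>
lemma is_pullback_of_full_sub:
  assumes "category C" and pb: "is_pullback (full_sub C P) j f p q"
    and pb': "is_pullback C j f p' q'" and vertex: "P (Dom C p')"
  shows "is_pullback C j f p q"
proof -
  interpret category C by (rule assms)
  let ?S = "full_sub C P"
  note D = is_pullbackD[OF pb, unfolded full_sub_simps] and D' = is_pullbackD[OF pb']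
  have P: "P (Dom C p)" "P (Dom C f)" "P (Dom C j)" "P (Cod C j)"
    using D(1,3,4) by (auto simp: hom_full_sub)
  have p: "p \<in> hom C (Dom C p) (Dom C f)" and q: "q \<in> hom C (Dom C p) (Dom C j)"
    using D(1,2) by (auto simp: hom_full_sub)
  obtain d where d: "d \<in> hom C (Dom C p') (Dom C p)" "Comp C p d = p'" "Comp C q d = q'"
    using D(6)[of p' "Dom C p'" q'] D'(1,2,5) P vertex by (auto simp: hom_full_sub)
  obtain e where e: "e \<in> hom C (Dom C p) (Dom C p')" "Comp C p' e = p" "Comp C q' e = q"
    using D'(6)[OF p q D(5)] by blast
  have de: "Comp C d e = Ident C (Dom C p)"
  proof (rule pullback_jointly_monic[OF category_full_sub[OF assms(1)] pb])
    show "Comp C d e \<in> hom ?S (Dom C p) (Dom ?S p)"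
      using Comp_hom[OF e(1) d(1)] P by (simp add: hom_full_sub)
    show "Ident C (Dom C p) \<in> hom ?S (Dom C p) (Dom ?S p)"
      using Ident_hom[OF Dom_closed, of p] p P by (simp add: hom_full_sub hom_def)
    show "Comp ?S p (Comp C d e) = Comp ?S p (Ident C (Dom C p))"
      using Comp_assoc[OF e(1) d(1) p] d e Comp_Ident_right[OF p] by simp
    show "Comp ?S q (Comp C d e) = Comp ?S q (Ident C (Dom C p))"
      using Comp_assoc[OF e(1) d(1) q] d e Comp_Ident_right[OF q] by simp
  qed
  have ex: "\<exists>!w. w \<in> hom C x (Dom C p) \<and> Comp C p w = u \<and> Comp C q w = v"
    if uv: "u \<in> hom C x (Dom C f)" "v \<in> hom C x (Dom C j)" "Comp C f u = Comp C j v" for x u v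
  proof -
    obtain w where w: "w \<in> hom C x (Dom C p')" "Comp C p' w = u" "Comp C q' w = v"
      using D'(6)[OF uv] by blast
    show ?thesis
    proof (rule ex1I[of _ "Comp C d w"])
      show "Comp C d w \<in> hom C x (Dom C p) \<and> Comp C p (Comp C d w) = u \<and> Comp C q (Comp C d w) = v"
        using Comp_hom[OF w(1) d(1)] Comp_assoc[OF w(1) d(1) p] Comp_assoc[OF w(1) d(1) q] d w
        by simp
    next
      fix t assume t: "t \<in> hom C x (Dom C p) \<and> Comp C p t = u \<and> Comp C q t = v"
      then have th: "t \<in> hom C x (Dom C p)" by simp
      have "Comp C e t = w"
      proof (rule pullback_jointly_monic[OF assms(1) pb'])
        show "Comp C p' (Comp C e t) = Comp C p' w" "Comp C q' (Comp C e t) = Comp C q' w"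
          using Comp_assoc[OF th e(1) D'(1)] Comp_assoc[OF th e(1) D'(2)] e t w by simp_all
      qed (use Comp_hom[OF th e(1)] w in auto)
      then show "t = Comp C d w"
        using Comp_assoc[OF th e(1) d(1)] de Comp_Ident_left[OF th] by simp
    qed
  qed
  show ?thesis
    unfolding is_pullback_def
  proof (intro conjI allI ballI impI)
    show "j \<in> Ar C" "f \<in> Ar C" "Cod C j = Cod C f" "p \<in> Ar C" "q \<in> Ar C" "Dom C p = Dom C q"
      "Cod C p = Dom C f" "Cod C q = Dom C j" "Comp C f p = Comp C j q"
      using pb by (auto simp: is_pullback_def)
  qed (rule ex)
qed


section \<open>Full subcategories closed under domains of base arrows\<close>

definition full_based :: "('o, 'a) based_cat \<Rightarrow> ('o \<Rightarrow> bool) \<Rightarrow> ('o, 'a) based_cat" where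
  "full_based X P = \<lparr>Cat = full_sub (Cat X) P, Base = \<lambda>c. Base X c \<inter> Ar (full_sub (Cat X) P)\<rparr>"

lemma full_based_simps [simp]:
  "Cat (full_based X P) = full_sub (Cat X) P"
  "Base (full_based X P) c = Base X c \<inter> Ar (full_sub (Cat X) P)"
  by (simp_all add: full_based_def)

lemma Eq_based_conv_full_based: "Eq_based X \<alpha> \<beta> = full_based X (\<lambda>c. At \<alpha> c = At \<beta> c)"
  by (auto simp: Eq_based_def full_based_def Eq_cat_def full_sub_def Equi_def fun_eq_iff)

lemma is_based_catD:
  assumes "is_based_cat X"
  shows "category (Cat X)"
    "a \<in> Ob (Cat X) \<Longrightarrow> i \<in> Base X a \<Longrightarrow> monic (Cat X) i"
    "a \<in> Ob (Cat X) \<Longrightarrow> i \<in> Base X a \<Longrightarrow> i \<in> hom (Cat X) (Dom (Cat X) i) a"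
    "a \<in> Ob (Cat X) \<Longrightarrow> Ident (Cat X) a \<in> Base X a"
    "a \<in> Ob (Cat X) \<Longrightarrow> b \<in> Ob (Cat X) \<Longrightarrow> i \<in> Base X a \<Longrightarrow> j \<in> Base X b \<Longrightarrow>
       f \<in> hom (Cat X) (Dom (Cat X) i) b \<Longrightarrow>
       \<exists>p q. is_pullback (Cat X) j f p q \<and> Comp (Cat X) i p \<in> Base X a"
  using assms unfolding is_based_cat_def computability_base_def monic_def hom_def by auto

definition inherited_along_base :: "('o, 'a) based_cat \<Rightarrow> ('o \<Rightarrow> bool) \<Rightarrow> bool" where
  "inherited_along_base X P \<longleftrightarrow>
     (\<forall>a \<in> Ob (Cat X). \<forall>i \<in> Base X a. P a \<longrightarrow> P (Dom (Cat X) i))"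

lemma based_cat_full_based:
  assumes X: "is_based_cat X" and P: "inherited_along_base X P"
  shows "is_based_cat (full_based X P)"
proof -
  let ?C = "Cat X" and ?S = "full_sub (Cat X) P"
  interpret category ?C by (rule is_based_catD(1)[OF X])
  note B = is_based_catD[OF X]
  have "monic ?S i \<and> Cod ?S i = a" if "a \<in> Ob ?S" "i \<in> Base X a \<inter> Ar ?S" for a i
    using that B(2,3)[of a i] monic_full_sub[of ?C i P] by (auto simp: hom_def)
  moreover have "Ident ?S a \<in> Base X a \<inter> Ar ?S" if "a \<in> Ob ?S" for a
    using that B(4)[of a] Ident_hom[of a] by (auto simp: hom_def)
  moreover have "\<exists>p q. is_pullback ?S j f p q \<and> Comp ?S i p \<in> Base X a \<inter> Ar ?S"
    if a: "a \<in> Ob ?S" and b: "b \<in> Ob ?S" and i: "i \<in> Base X a \<inter> Ar ?S"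
      and j: "j \<in> Base X b \<inter> Ar ?S" and f: "f \<in> hom ?S (Dom ?S i) b" for a b i j f
  proof -
    obtain p q where pb: "is_pullback ?C j f p q" and ip: "Comp ?C i p \<in> Base X a"
      using B(5)[of a b i j f] a b i j f by (auto simp: hom_full_sub)
    have hi: "i \<in> hom ?C (Dom ?C i) a" and hj: "j \<in> hom ?C (Dom ?C j) b"
      using B(3)[of a i] B(3)[of b j] a b i j by auto
    have hp: "p \<in> hom ?C (Dom ?C p) (Dom ?C i)"
      using is_pullbackD(1)[OF pb] f by (auto simp: hom_full_sub hom_def)
    have hip: "Comp ?C i p \<in> hom ?C (Dom ?C p) a" by (rule Comp_hom[OF hp hi])
    \<comment> \<open>The vertex of the pullback is the domain of the base arrow \<open>i \<circ> p\<close>.\<close>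
    have v: "P (Dom ?C p)"
      using P ip hip a unfolding inherited_along_base_def hom_def by fastforce
    have "is_pullback ?S j f p q"
      using is_pullback_full_sub[OF pb] v i j f hj by (auto simp: hom_full_sub hom_def)
    then show ?thesis using ip hip v a by (auto simp: hom_def)
  qed
  ultimately show ?thesis
    using category_full_sub[OF B(1)]
    unfolding is_based_cat_def computability_base_def full_based_simps by blast
qed

lemma inclusion_simps [simp]:
  "Src (inclusion S X) = S" "Trg (inclusion S X) = X"
  "x \<in> Ob (Cat S) \<Longrightarrow> OMap (inclusion S X) x = x"
  "f \<in> Ar (Cat S) \<Longrightarrow> AMap (inclusion S X) f = f"
  by (simp_all add: inclusion_def)

lemma transfer_inclusion:
  assumes X: "is_based_cat X" and P: "inherited_along_base X P"
  shows "is_transfer (inclusion (full_based X P) X)"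
proof -
  let ?C = "Cat X" and ?S = "full_sub (Cat X) P" and ?I = "inclusion (full_based X P) X"
  interpret category ?C by (rule is_based_catD(1)[OF X])
  interpret S: category ?S by (rule category_full_sub[OF category_axioms])
  note B = is_based_catD[OF X]
  have "is_functor ?S ?C (OMap ?I) (AMap ?I)"
    unfolding is_functor_def
  proof (intro conjI ballI impI)
    fix f assume "f \<in> Ar ?S"
    then show "AMap ?I f \<in> hom ?C (OMap ?I (Dom ?S f)) (OMap ?I (Cod ?S f))"
      using Dom_closed[of f] Cod_closed[of f] by (simp add: hom_def)
  next
    fix x assume "x \<in> Ob ?S"
    then show "AMap ?I (Ident ?S x) = Ident ?C (OMap ?I x)"
      using S.Ident_hom[of x] by (simp add: hom_def)
  next
    fix f g assume fg: "f \<in> Ar ?S" "g \<in> Ar ?S" "Cod ?S f = Dom ?S g"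
    then have "Comp ?S g f \<in> Ar ?S"
      using S.Comp_hom[of f "Dom ?S f" "Cod ?S f" g "Cod ?S g"] by (simp add: hom_def)
    then show "AMap ?I (Comp ?S g f) = Comp ?C (AMap ?I g) (AMap ?I f)"
      using fg by simp
  qed simp
  moreover have "is_pullback ?C j f p q"
    if b: "b \<in> Ob ?S" and j: "j \<in> Base (full_based X P) b" and pb: "is_pullback ?S j f p q"
    for b j f p q
  proof -
    have s: "Dom ?C f \<in> Ob ?C" "P (Dom ?C f)" and f: "f \<in> hom ?C (Dom ?C f) b"
      using is_pullbackD(3)[OF pb] B(3)[of b j] b j by (auto simp: hom_def Dom_closed)
    have i: "Dom ?C (Ident ?C (Dom ?C f)) = Dom ?C f"
      using Ident_hom[OF s(1)] by (simp add: hom_def)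
    \<comment> \<open>The second base axiom, applied with an identity as \<open>i\<close>, places the vertex in \<open>P\<close>.\<close>
    obtain p' q' where pb': "is_pullback ?C j f p' q'"
      and p': "Comp ?C (Ident ?C (Dom ?C f)) p' \<in> Base X (Dom ?C f)"
      using B(5)[of "Dom ?C f" b "Ident ?C (Dom ?C f)" j f] B(4)[OF s(1)] b j f s i by auto
    have "p' \<in> Base X (Dom ?C f)"
      using p' Comp_Ident_left[OF is_pullbackD(1)[OF pb']] by simp
    then have "P (Dom ?C p')"
      using P s unfolding inherited_along_base_def by blast
    then show ?thesis
      by (rule is_pullback_of_full_sub[OF category_axioms pb pb'])
  qed
  moreover have "j \<in> Ar ?S \<and> f \<in> Ar ?S \<and> p \<in> Ar ?S \<and> q \<in> Ar ?S" if "is_pullback ?S j f p q"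
    for j f p q using that unfolding is_pullback_def by blast
  ultimately show ?thesis
    using X based_cat_full_based[OF X P]
    by (simp add: is_transfer_def inclusion_def[THEN arg_cong[of _ _ OMap]]
        inclusion_def[THEN arg_cong[of _ _ AMap]])
qed

text \<open>
  Corestriction keeps the preservation of pullbacks because a pullback in the ambient category whose
  corners satisfy \<open>P\<close> is one in the full subcategory.
\<close>
lemma is_transfer_corestrict:
  assumes X: "is_based_cat X" and P: "inherited_along_base X P"
    and H: "is_transfer H" "Trg H = X" and val: "\<And>x. x \<in> Ob (Cat (Src H)) \<Longrightarrow> P (OMap H x)"
  shows "is_transfer (H\<lparr>Trg := full_based X P\<rparr>)"
proof -
  let ?J = "Cat (Src H)" and ?S = "full_sub (Cat X) P"
  interpret J: category ?J by (rule is_transferD(3)[OF H(1)])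
  have hom: "AMap H f \<in> hom ?S (OMap H (Dom ?J f)) (OMap H (Cod ?J f))" if "f \<in> Ar ?J" for f
    using is_transferD(8)[OF H(1), of f "Dom ?J f" "Cod ?J f"] H(2) that
      val[OF J.Dom_closed[OF that]] val[OF J.Cod_closed[OF that]]
    by (simp add: hom_full_sub) (simp add: hom_def)
  have ar: "AMap H f \<in> Ar ?S" if "f \<in> Ar ?J" for f
    by (rule hom_in_Ar[OF hom[OF that]])
  have "is_functor ?J ?S (OMap H) (AMap H)"
    using H hom val by (auto simp: is_transfer_def Let_def is_functor_def)
  moreover have "AMap H i \<in> Base (full_based X P) (OMap H a)"
    if "a \<in> Ob ?J" "i \<in> Base (Src H) a" for a i
    using that H ar[of i] is_based_catD(3)[OF is_transferD(1)[OF H(1)] that]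
    by (auto simp: is_transfer_def Let_def hom_def)
  moreover have "is_pullback ?S (AMap H j) (AMap H f) (AMap H p) (AMap H q)"
    if "b \<in> Ob ?J" "j \<in> Base (Src H) b" "is_pullback ?J j f p q" for b j f p q
  proof (rule is_pullback_full_sub)
    show "is_pullback (Cat X) (AMap H j) (AMap H f) (AMap H p) (AMap H q)"
      using H that by (auto simp: is_transfer_def Let_def)
    show "P (Dom (Cat X) (AMap H j))" "P (Dom (Cat X) (AMap H f))" "P (Cod (Cat X) (AMap H j))"
      "P (Dom (Cat X) (AMap H p))"
      using that(3) ar by (auto simp: is_pullback_def)
  qed
  ultimately show ?thesis
    using H based_cat_full_based[OF X P] is_transferD(1,5,6)[OF H(1)]
    by (simp add: is_transfer_def Let_def)
qed

lemma comp_inclusion_simps: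
  assumes h: "is_transfer h" and "Trg h = full_based X P"
  shows "x \<in> Ob (Cat (Src h)) \<Longrightarrow>
      OMap (comp_transfer (inclusion (full_based X P) X) h) x = OMap h x"
    and "f \<in> Ar (Cat (Src h)) \<Longrightarrow>
      AMap (comp_transfer (inclusion (full_based X P) X) h) f = AMap h f"
proof -
  assume "f \<in> Ar (Cat (Src h))"
  moreover from this have "AMap h f \<in> Ar (Cat (full_based X P))"
    using is_transferD(8)[OF h, of f "Dom (Cat (Src h)) f" "Cod (Cat (Src h)) f"]
    unfolding assms(2) by (intro hom_in_Ar) (simp add: hom_def[of "Cat (Src h)"])
  ultimately show "AMap (comp_transfer (inclusion (full_based X P) X) h) f = AMap h f"
    by simp
qed (use is_transferD(7)[OF h, of x] assms(2) in simp)

lemma ex1_corestriction: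
  assumes X: "is_based_cat X" and P: "inherited_along_base X P"
    and H: "is_transfer H" "Trg H = X" and val: "\<And>x. x \<in> Ob (Cat (Src H)) \<Longrightarrow> P (OMap H x)"
  shows "\<exists>!h. one_cell CatBaseComp h (Src H) (full_based X P) \<and>
    H = comp_transfer (inclusion (full_based X P) X) h"
proof -
  let ?I = "inclusion (full_based X P) X" and ?h = "H\<lparr>Trg := full_based X P\<rparr>"
  have h: "is_transfer ?h" by (rule is_transfer_corestrict[OF assms])
  note c = comp_inclusion_simps[OF h, of X P, simplified]
  have "H = comp_transfer ?I ?h"
    using H(2) c by (intro transfer_eqI[OF H(1) is_comp_transfer[OF h transfer_inclusion[OF X P]]]) auto
  moreover have "h' = ?h" if h': "one_cell CatBaseComp h' (Src H) (full_based X P)"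
    and eq: "H = comp_transfer ?I h'" for h'
  proof -
    have h'': "is_transfer h'" "Src h' = Src H" "Trg h' = full_based X P"
      using h' by (auto simp: one_cell_def)
    note c' = comp_inclusion_simps[OF h''(1,3), folded eq, unfolded h''(2)]
    show ?thesis
      by (rule transfer_eqI[OF h''(1) h]) (use h'' c' in auto)
  qed
  ultimately show ?thesis
    using h by (auto simp: one_cell_def intro!: ex1I[of _ ?h])
qed


section \<open>Transformations into a full subcategory, and whiskering\<close>

lemma At_whisker_left_inclusion:
  assumes X: "is_based_cat X" and P: "inherited_along_base X P"
    and m: "is_transformation \<mu>" "Trg (NSrc \<mu>) = full_based X P" and x: "x \<in> Ob (Cat (Src (NSrc \<mu>)))"
  shows "At (whisker_left CatBaseComp (inclusion (full_based X P) X) \<mu>) x = At \<mu> x"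
proof -
  interpret category "Cat X" by (rule is_based_catD(1)[OF X])
  have hx: "OMap (NSrc \<mu>) x \<in> Ob (full_sub (Cat X) P)"
    using is_transferD(7)[OF is_transformationD(1)[OF m(1)] x] m(2) by simp
  have mx: "At \<mu> x \<in> hom (full_sub (Cat X) P) (OMap (NSrc \<mu>) x) (OMap (NTrg \<mu>) x)"
    using is_transformationD(6)[OF m(1) x] m(2) by simp
  then have "At \<mu> x \<in> hom (Cat X) (OMap (NSrc \<mu>) x) (OMap (NTrg \<mu>) x)"
    and "At \<mu> x \<in> Ar (full_sub (Cat X) P)"
    by (auto simp: hom_def)
  then show ?thesis
    using x hx Comp_Ident_right by (simp add: whisker_left_def)
qed

text \<open>
  The 2-dimensional half of the universal property. Whiskering with the inclusion leaves the
  components unchanged, and by fullness the components of \<open>\<nu>\<close> are already arrows of the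
  subcategory, so \<open>\<mu>\<close> has to be, and can be, \<open>\<nu>\<close> with source and target replaced.
\<close>
lemma ex1_whisker_inclusion:
  assumes X: "is_based_cat X" and P: "inherited_along_base X P"
    and h: "one_cell CatBaseComp h J (full_based X P)" and h': "one_cell CatBaseComp h' J (full_based X P)"
    and n: "two_cell CatBaseComp \<nu> (comp_transfer (inclusion (full_based X P) X) h)
      (comp_transfer (inclusion (full_based X P) X) h')"
  shows "\<exists>!\<mu>. two_cell CatBaseComp \<mu> h h' \<and>
    whisker_left CatBaseComp (inclusion (full_based X P) X) \<mu> = \<nu>"
proof -
  let ?S = "full_based X P" and ?I = "inclusion (full_based X P) X"
  let ?J = "Cat J"
  have H: "is_transfer h" "Src h = J" "Trg h = ?S" and H': "is_transfer h'" "Src h' = J" "Trg h' = ?S"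
    using h h' by (auto simp: one_cell_def)
  have N: "is_transformation \<nu>" "NSrc \<nu> = comp_transfer ?I h" "NTrg \<nu> = comp_transfer ?I h'"
    using n by (auto simp: two_cell_def)
  note c = comp_inclusion_simps[OF H(1,3), unfolded H(2)]
    and c' = comp_inclusion_simps[OF H'(1,3), unfolded H'(2)]
  note I = transfer_inclusion[OF X P]
  define \<mu> where "\<mu> = \<lparr>NSrc = h, NTrg = h', At = At \<nu>\<rparr>"
  have ms [simp]: "NSrc \<mu> = h" "NTrg \<mu> = h'" "At \<mu> = At \<nu>" by (simp_all add: \<mu>_def)
  have W: "is_transformation (whisker_left CatBaseComp ?I m)" "NSrc (whisker_left CatBaseComp ?I m) = NSrc \<nu>"
    "NTrg (whisker_left CatBaseComp ?I m) = NTrg \<nu>"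
    if "two_cell CatBaseComp m h h'" for m
    using that H H' N I
    by (auto simp: whisker_left_def two_cell_def intro!: is_hcomp_transformation is_id_transformation)
  have "is_transformation \<mu>"
  proof (rule is_transformationI, goal_cases)
    case 5
    then show ?case using is_transformationD(5)[OF N(1)] N(2) by simp
  next
    case (6 x)
    then have "At \<nu> x \<in> hom (Cat X) (OMap h x) (OMap h' x)"
      using is_transformationD(6)[OF N(1), of x] c c' N H by simp
    then show ?case
      using is_transferD(7)[OF H(1), of x] is_transferD(7)[OF H'(1), of x] 6 H H'
      by (simp add: hom_full_sub)
  next
    case (7 f x y)
    then have "f \<in> Ar ?J" using H by (simp add: hom_def)
    then show ?case
      using 7 is_transformationD(7)[OF N(1), of f x y] c c' N H by simp
  qed (use H H' in auto)
  then have cell: "two_cell CatBaseComp \<mu> h h'" by (simp add: two_cell_def)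
  show ?thesis
  proof (rule ex1I[of _ \<mu>])
    have "whisker_left CatBaseComp ?I \<mu> = \<nu>"
    proof (rule transformation_eqI[OF W(1)[OF cell] N(1)])
      fix x assume "x \<in> Ob (Cat (Src (NSrc \<nu>)))"
      then show "At (whisker_left CatBaseComp ?I \<mu>) x = At \<nu> x"
        using At_whisker_left_inclusion[OF X P \<open>is_transformation \<mu>\<close>, of x] H N by simp
    qed (use W[OF cell] in auto)
    then show "two_cell CatBaseComp \<mu> h h' \<and> whisker_left CatBaseComp ?I \<mu> = \<nu>"
      using cell by simp
  next
    fix m assume m: "two_cell CatBaseComp m h h' \<and> whisker_left CatBaseComp ?I m = \<nu>"
    then have m': "is_transformation m" "NSrc m = h" "NTrg m = h'" by (auto simp: two_cell_def)
    show "m = \<mu>"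
    proof (rule transformation_eqI[OF m'(1) \<open>is_transformation \<mu>\<close>])
      fix x assume "x \<in> Ob (Cat (Src (NSrc \<mu>)))"
      then show "At m x = At \<mu> x"
        using At_whisker_left_inclusion[OF X P m'(1), of x] m m' H by simp
    qed (use m' in auto)
  qed
qed

text \<open>
  The component is \<open>G' (1\<^bsub>j x\<^esub>) \<circ> \<tau>\<^bsub>j x\<^esub>\<close>, where \<open>G'\<close> is the target of \<open>\<tau>\<close>, and \<open>G'\<close> preserves the
  identity.
\<close>
lemma At_whisker_right:
  assumes t: "is_transformation \<tau>" and j: "is_transfer j" "Trg j = Src (NSrc \<tau>)"
    and x: "x \<in> Ob (Cat (Src j))"
  shows "At (whisker_right CatBaseComp \<tau> j) x = At \<tau> (OMap j x)"
proof -
  note T = is_transformationD[OF t]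
  interpret category "Cat (Trg (NSrc \<tau>))" by (rule is_transferD(4)[OF T(1)])
  have jx: "OMap j x \<in> Ob (Cat (Src (NSrc \<tau>)))"
    using is_transferD(7)[OF j(1) x] j(2) by simp
  have "AMap (NTrg \<tau>) (Ident (Cat (Src (NSrc \<tau>))) (OMap j x)) =
      Ident (Cat (Trg (NSrc \<tau>))) (OMap (NTrg \<tau>) (OMap j x))"
    using is_transferD(9)[OF T(2), of "OMap j x"] jx T(3,4) by simp
  then show ?thesis
    using x j(2) Comp_Ident_left[OF T(6)[OF jx]] by (simp add: whisker_right_def)
qed

lemma equifies_iff:
  assumes a: "two_cell CatBaseComp \<alpha> F G" and b: "two_cell CatBaseComp \<beta> F G"
    and j: "is_transfer j" "Trg j = Src F"
  shows "equifies CatBaseComp \<alpha> \<beta> j \<longleftrightarrow>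
    (\<forall>x \<in> Ob (Cat (Src j)). At \<alpha> (OMap j x) = At \<beta> (OMap j x))"
proof -
  have A: "is_transformation \<alpha>" "NSrc \<alpha> = F" "NTrg \<alpha> = G"
    and B: "is_transformation \<beta>" "NSrc \<beta> = F" "NTrg \<beta> = G"
    using a b by (auto simp: two_cell_def)
  have at: "At (whisker_right CatBaseComp \<alpha> j) x = At \<alpha> (OMap j x)"
    "At (whisker_right CatBaseComp \<beta> j) x = At \<beta> (OMap j x)" if "x \<in> Ob (Cat (Src j))" for x
    using At_whisker_right[OF A(1) j(1) _ that] At_whisker_right[OF B(1) j(1) _ that] A B j by auto
  have tr: "is_transformation (whisker_right CatBaseComp \<alpha> j)"
    "is_transformation (whisker_right CatBaseComp \<beta> j)"
    using A B j
    by (auto simp: whisker_right_def intro!: is_hcomp_transformation is_id_transformation)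
  show ?thesis
  proof
    assume "equifies CatBaseComp \<alpha> \<beta> j"
    then show "\<forall>x \<in> Ob (Cat (Src j)). At \<alpha> (OMap j x) = At \<beta> (OMap j x)"
      using at by (simp add: equifies_def)
  next
    assume "\<forall>x \<in> Ob (Cat (Src j)). At \<alpha> (OMap j x) = At \<beta> (OMap j x)"
    then show "equifies CatBaseComp \<alpha> \<beta> j"
      unfolding equifies_def
      by (intro transformation_eqI[OF tr]) (use at A B in \<open>simp_all add: whisker_right_def\<close>)
  qed
qed


section \<open>The equifier\<close>

text \<open>
  By naturality \<open>G i\<close> has the same composite with \<open>\<alpha>\<^sub>s\<close> as with \<open>\<beta>\<^sub>s\<close>, and it is monic since \<open>G\<close> maps
  the base arrow \<open>i : s \<rightarrow> a\<close> to a base arrow.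
\<close>
lemma transformations_agree_on_domain:
  assumes a: "two_cell CatBaseComp \<alpha> F G" and b: "two_cell CatBaseComp \<beta> F G"
  shows "inherited_along_base (Src F) (\<lambda>c. At \<alpha> c = At \<beta> c)"
  unfolding inherited_along_base_def
proof (intro ballI impI)
  let ?C = "Cat (Src F)" and ?D = "Cat (Trg F)"
  fix a i assume ob: "a \<in> Ob ?C" and i: "i \<in> Base (Src F) a" and eq: "At \<alpha> a = At \<beta> a"
  let ?s = "Dom ?C i"
  have A: "is_transformation \<alpha>" "NSrc \<alpha> = F" "NTrg \<alpha> = G"
    and B: "is_transformation \<beta>" "NSrc \<beta> = F" "NTrg \<beta> = G"
    using a b by (auto simp: two_cell_def)
  have F: "is_transfer F" and G: "is_transfer G" and FG: "Src G = Src F" "Trg G = Trg F"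
    using is_transformationD(1-4)[OF A(1)] A by auto
  have hi: "i \<in> hom ?C ?s a" by (rule is_based_catD(3)[OF is_transferD(1)[OF F] ob i])
  have s: "?s \<in> Ob ?C"
    using category.Dom_closed[OF is_transferD(3)[OF F]] hi by (simp add: hom_def)
  have "AMap G i \<in> Base (Trg G) (OMap G a)" and Ga: "OMap G a \<in> Ob (Cat (Trg G))"
    using G ob i FG by (auto simp: is_transfer_def Let_def is_functor_def)
  then have mono: "monic ?D (AMap G i)"
    using is_based_catD(2)[OF is_transferD(2)[OF G] Ga] FG by simp
  have dom: "Dom ?D (AMap G i) = OMap G ?s"
    using is_transferD(8)[OF G, of i ?s a] hi FG by (simp add: hom_def)
  have "Comp ?D (AMap G i) (At \<alpha> ?s) = Comp ?D (AMap G i) (At \<beta> ?s)"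
    using is_transformationD(7)[OF A(1), of i ?s a] is_transformationD(7)[OF B(1), of i ?s a]
      A B hi eq by simp
  moreover have "At \<alpha> ?s \<in> hom ?D (OMap F ?s) (OMap G ?s)"
    "At \<beta> ?s \<in> hom ?D (OMap F ?s) (OMap G ?s)"
    using is_transformationD(6)[OF A(1), of ?s] is_transformationD(6)[OF B(1), of ?s] A B s by auto
  ultimately show "At \<alpha> ?s = At \<beta> ?s"
    using mono unfolding monic_def dom by blast
qed

theorem lemma3p7:
  fixes X Y :: "('o, 'a) based_cat"
    and F G :: "('o, 'a) transfer"
    and \<alpha> \<beta> :: "('o, 'a) transformation"
  assumes "one_cell CatBaseComp F X Y"
    and "one_cell CatBaseComp G X Y"
    and "two_cell CatBaseComp \<alpha> F G"
    and "two_cell CatBaseComp \<beta> F G"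
  shows "is_equifier CatBaseComp X Y F G \<alpha> \<beta> (Eq_based X \<alpha> \<beta>) (inclusion (Eq_based X \<alpha> \<beta>) X)"
proof -
  let ?P = "\<lambda>c. At \<alpha> c = At \<beta> c"
  let ?S = "full_based X ?P"
  let ?I = "inclusion ?S X"
  have F: "is_transfer F" "Src F = X" using assms(1) by (auto simp: one_cell_def)
  have X: "is_based_cat X" using is_transferD(1)[OF F(1)] F(2) by simp
  have P: "inherited_along_base X ?P"
    using transformations_agree_on_domain[OF assms(3,4)] F by simp
  have S: "is_based_cat ?S" and I: "is_transfer ?I"
    by (rule based_cat_full_based[OF X P], rule transfer_inclusion[OF X P])
  have eq_iff: "equifies CatBaseComp \<alpha> \<beta> j \<longleftrightarrow> (\<forall>x \<in> Ob (Cat (Src j)). ?P (OMap j x))"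
    if "is_transfer j" "Trg j = X" for j
    using equifies_iff[OF assms(3,4) that(1)] that(2) F by simp
  show ?thesis
    unfolding is_equifier_def Eq_based_conv_full_based
  proof (intro conjI ballI allI impI; (elim conjE)?)
    show "one_cell CatBaseComp ?I ?S X" "?S \<in> Obj CatBaseComp"
      using S I by (simp_all add: one_cell_def)
    show "equifies CatBaseComp \<alpha> \<beta> ?I"
      using eq_iff[OF I] by simp
  next
    fix J j assume "one_cell CatBaseComp j J X" "equifies CatBaseComp \<alpha> \<beta> j"
    then show "\<exists>!h. one_cell CatBaseComp h J ?S \<and> j = comp1 CatBaseComp ?I h"
      using ex1_corestriction[OF X P, of j] eq_iff[of j] by (simp add: one_cell_def)
  next
    fix J j j' h h' \<nu>
    assume "one_cell CatBaseComp h J ?S" "one_cell CatBaseComp h' J ?S"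
      "j = comp1 CatBaseComp ?I h" "j' = comp1 CatBaseComp ?I h'" "two_cell CatBaseComp \<nu> j j'"
    then show "\<exists>!\<mu>. two_cell CatBaseComp \<mu> h h' \<and> whisker_left CatBaseComp ?I \<mu> = \<nu>"
      using ex1_whisker_inclusion[OF X P, of h J h' \<nu>] by simp
  qed (use assms in simp_all)
qed

end
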